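(* Let $t$ be a positive integer and let $d=2^{2t+1}$. Then there exists a set of $d$ mutually quasi-unbiased weighing matrices for parameters $(d,d,d/2,2d)$; that is, there exist weighing matrices $W_1,\ldots,W_d$ of order $d$ and weight $d$ such that for all distinct $i,j$ the matrix $\frac{1}{\sqrt{2d}}W_iW_j^T$ is a weighing matrix of order $d$ and weight $d/2$.
   Context: A weighing matrix of order $d$ and weight $k$ is a square $d\times d$ matrix $W$ with entries in $\{0,1,-1\}$ such that $WW^T=kI$. Two weighing matrices $W_1,W_2$ of order $d$ and weight $k$ are quasi-unbiased for parameters $(d,k,l,a)$ (with $a,l$ positive integers) if $\frac{1}{\sqrt a}W_1W_2^T$ is a weighing matrix of weight $l$ (necessarily $l=k^2/a$). A set of weighing matrices is a set of mutually quasi-unbiased weighing matrices (MQUWM) for parameters $(d,k,l,a)$ if any two distinct members are quasi-unbiased for parameters $(d,k,l,a)$. *)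

theory Defs
  imports Complex_Main "Jordan_Normal_Form.Matrix"
begin

definition weighing_matrix :: "nat \<Rightarrow> nat \<Rightarrow> real mat \<Rightarrow> bool" where
  "weighing_matrix d k W \<longleftrightarrow>
     W \<in> carrier_mat d d \<and> elements_mat W \<subseteq> {0, 1, -1} \<and>
     W * transpose_mat W = real k \<cdot>\<^sub>m 1\<^sub>m d"

definition quasi_unbiased :: "nat \<Rightarrow> nat \<Rightarrow> nat \<Rightarrow> nat \<Rightarrow> real mat \<Rightarrow> real mat \<Rightarrow> bool" where
  "quasi_unbiased d k l a W\<^sub>1 W\<^sub>2 \<longleftrightarrow>
     0 < a \<and> 0 < l \<and> weighing_matrix d k W\<^sub>1 \<and> weighing_matrix d k W\<^sub>2 \<and>
     weighing_matrix d l ((1 / sqrt (real a)) \<cdot>\<^sub>m (W\<^sub>1 * transpose_mat W\<^sub>2))"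

definition MQUWM :: "nat \<Rightarrow> nat \<Rightarrow> nat \<Rightarrow> nat \<Rightarrow> real mat set \<Rightarrow> bool" where
  "MQUWM d k l a S \<longleftrightarrow>
     (\<forall>W\<in>S. weighing_matrix d k W) \<and>
     (\<forall>W\<^sub>1\<in>S. \<forall>W\<^sub>2\<in>S. W\<^sub>1 \<noteq> W\<^sub>2 \<longrightarrow> quasi_unbiased d k l a W\<^sub>1 W\<^sub>2)"

end

theory Submission
  imports Defs "HOL-Algebra.Algebraic_Closure_Type" "HOL-Library.Z2"
    "Jordan_Normal_Form.Determinant"
begin

text \<open>
  Let \<open>F\<close> be the field with \<open>d = 2\<^sup>m\<close> elements, \<open>m = 2t + 1\<close>, realised inside the algebraic closure
  of the two-element field, and let \<open>\<chi> = (-1)\<^sup>T\<^sup>r\<close> be its canonical additive character. For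
  \<open>a \<in> F\<close> put \<open>W\<^sub>a = (\<chi> (a x\<^sup>3 + b x))\<close>, with rows indexed by \<open>b\<close> and columns by \<open>x\<close>. The entries of
  \<open>W\<^sub>a W\<^sub>c\<^sup>T\<close> are the Walsh coefficients \<open>S = \<Sum>x. \<chi> (u x\<^sup>3 + v x)\<close> with \<open>u = a - c\<close>. The polar form of
  \<open>Tr (u x\<^sup>3)\<close> has radical \<open>{y. u y + u\<^sup>2 y\<^sup>4 = 0}\<close>; as \<open>m\<close> is odd, cubing permutes \<open>F\<close>, so for
  \<open>u \<noteq> 0\<close> the radical has exactly two elements. Squaring \<open>S\<close> then gives
  \<open>S\<^sup>2 = d (1 \<plusminus> 1) \<in> {0, 2d}\<close>.
\<close>

section \<open>Counting roots over an algebraically closed field\<close>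

text \<open>A repeated linear factor would make the derivative vanish at its root. So the multiset
  of roots in the factorization is repetition-free and its size counts the distinct roots.\<close>

lemma card_roots_eq_degree:
  fixes p :: "'a :: alg_closed_field poly"
  assumes "p \<noteq> 0" and sep: "\<And>x. poly p x = 0 \<Longrightarrow> poly (pderiv p) x \<noteq> 0"
  shows "card {x. poly p x = 0} = degree p"
proof -
  obtain A where A: "size A = degree p" "p = smult (lead_coeff p) (\<Prod>x\<in>#A. [:-x, 1:])"
    using alg_closed_imp_factorization[OF assms(1)] by blast
  have lc: "lead_coeff p \<noteq> 0"
    using assms(1) by simp
  have roots: "{x. poly p x = 0} = set_mset A"
    by (subst A(2)) (use lc in \<open>auto simp: poly_prod_mset prod_mset_zero_iff image_iff\<close>)
  have "count A x = 1" if "x \<in># A" for x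
  proof (rule ccontr)
    assume "count A x \<noteq> 1"
    with that have "count A x \<ge> 2"
      by (metis count_greater_eq_one_iff le_neq_implies_less Suc_1 Suc_leI)
    then have "replicate_mset 2 x \<subseteq># A"
      by (simp add: count_le_replicate_mset_subset_eq)
    then obtain B where "A = replicate_mset 2 x + B"
      by (metis subset_mset.add_diff_inverse)
    then have "p = [:-x, 1:] * ([:-x, 1:] * smult (lead_coeff p) (\<Prod>x\<in>#B. [:-x, 1:]))"
      using A(2) by (simp add: numeral_2_eq_2 mult_ac)
    then obtain q where q: "p = [:-x, 1:] * ([:-x, 1:] * q)"
      by blast
    have "poly (pderiv p) x = 0"
      unfolding q by (simp only: pderiv_mult) simp
    moreover have "poly p x = 0"
      unfolding q by simp
    ultimately show False
      using sep by blast
  qed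
  then have "A = mset_set (set_mset A)"
    by (intro multiset_eqI) (metis count_mset_set(1,3) finite_set_mset not_in_iff)
  then have "size A = card (set_mset A)"
    by (metis size_mset_set)
  with A(1) roots show ?thesis
    by simp
qed

text \<open>In characteristic 2 the derivative of \<open>X ^ (2 ^ n) - X\<close> is the constant
  \<open>-1\<close>, so all its roots are simple. This supplies the size of the finite
  field.\<close>

lemma card_power_fixpoints_char_2:
  fixes n :: nat
  assumes two: "(2 :: 'a :: alg_closed_field) = 0" and "n > 0"
  shows "card {x :: 'a. x ^ (2 ^ n) = x} = 2 ^ n"
proof -
  define p :: "'a poly" where "p = monom 1 (2 ^ n) - monom 1 1"
  have n2: "(2 :: nat) ^ n > 1"
    using assms(2) by (intro one_less_power) auto
  have deg: "degree p = 2 ^ n"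
    unfolding p_def using n2
    by (subst diff_conv_add_uminus, subst degree_add_eq_left) (auto simp: degree_monom_eq)
  have "pderiv p = - 1"
    unfolding p_def using assms(2) two by (simp add: pderiv_diff pderiv_monom monom_0 one_pCons power_0_left)
  then have "card {x. poly p x = 0} = degree p"
    using deg by (intro card_roots_eq_degree) auto
  moreover have "{x. poly p x = 0} = {x. x ^ (2 ^ n) = x}"
    by (simp add: p_def poly_monom)
  ultimately show ?thesis
    using deg by simp
qed

lemma two_eq_0_bit_alg_closure: "(2 :: bit alg_closure) = 0"
  using to_ac_numeral[of "Num.Bit0 Num.One", where 'a = bit] by simp

section \<open>Scalar multiples of matrices\<close>

lemma smult_smult_mat: "a \<cdot>\<^sub>m (b \<cdot>\<^sub>m A) = (a * b :: 'a :: semigroup_mult) \<cdot>\<^sub>m A"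
  by (rule eq_matI) (auto simp: mult.assoc)

lemma one_smult_mat: "(1 :: 'a :: monoid_mult) \<cdot>\<^sub>m A = A"
  by (rule eq_matI) auto

lemma transpose_smult_mat: "transpose_mat (a \<cdot>\<^sub>m A) = a \<cdot>\<^sub>m transpose_mat A"
  by (rule eq_matI) auto

section \<open>Arithmetic of the binary field\<close>

text \<open>As \<open>d\<close> depends on \<open>t\<close>, the field is a set inside an ambient
  field and not a type. Closure under the operations comes from the equation
  \<open>x ^ d = x\<close>.\<close>

locale odd_binary_field =
  fixes F :: "'a :: field set" and t d :: nat
  assumes char2: "(2 :: 'a) = 0"
    and d_def: "d = 2 ^ (2 * t + 1)"
    and F_def: "F = {x. x ^ d = x}"
    and card_F: "card F = d"
begin

lemma d_pos: "d > 0"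
  by (simp add: d_def)

lemma finite_F: "finite F"
  using card_F d_pos card_ge_0_finite by metis

lemma add_self [simp]: "(x :: 'a) + x = 0"
  by (simp add: char2 flip: mult_2)

lemma add_self_left [simp]: "(x :: 'a) + (x + y) = y"
  by (simp flip: add.assoc)

lemma add_eq_0_iff_eq: "(x :: 'a) + y = 0 \<longleftrightarrow> x = y"
  by (metis add_self_left add.right_neutral add_self)

lemma square_add: "((x :: 'a) + y)\<^sup>2 = x\<^sup>2 + y\<^sup>2"
  by (simp add: power2_eq_square algebra_simps)

text \<open>Iterates the Frobenius map; this makes \<open>F\<close> closed under addition and
  \<open>Tr\<close> additive.\<close>

lemma power_2_power_add: "((x :: 'a) + y) ^ (2 ^ n) = x ^ (2 ^ n) + y ^ (2 ^ n)"
  by (induction n) (simp_all add: power_mult square_add mult.commute[of 2])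

lemma add_closed [intro]: "x \<in> F \<Longrightarrow> y \<in> F \<Longrightarrow> x + y \<in> F"
  by (simp add: F_def d_def power_2_power_add del: power_Suc power_add)

lemma mult_closed [intro]: "x \<in> F \<Longrightarrow> y \<in> F \<Longrightarrow> x * y \<in> F"
  by (simp add: F_def power_mult_distrib)

lemma inverse_closed [intro]: "x \<in> F \<Longrightarrow> inverse x \<in> F"
  by (simp add: F_def power_inverse)

lemma power_closed [intro]: "x \<in> F \<Longrightarrow> x ^ n \<in> F"
  by (simp add: F_def flip: power_mult) (simp add: mult.commute power_mult)

lemma zero_closed [intro]: "0 \<in> F"
  using d_pos by (simp add: F_def)

lemma one_closed [intro]: "1 \<in> F"
  by (simp add: F_def)

section \<open>Trace and additive character\<close>

definition Tr :: "'a \<Rightarrow> 'a" where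
  "Tr x = (\<Sum>i<2 * t + 1. x ^ (2 ^ i))"

lemma Tr_add: "Tr (x + y) = Tr x + Tr y"
  unfolding Tr_def by (simp only: power_2_power_add sum.distrib)

text \<open>Squaring shifts the summands by one place, and the last one, \<open>x ^ d\<close>, wraps
  around to \<open>x\<close>.\<close>

lemma Tr_square_arg:
  assumes "x \<in> F"
  shows "Tr (x\<^sup>2) = Tr x"
proof -
  have "Tr (x\<^sup>2) = (\<Sum>i<2 * t + 1. x ^ (2 ^ Suc i))"
    by (simp add: Tr_def flip: power_mult)
  moreover have "(\<Sum>i<Suc (2 * t + 1). x ^ (2 ^ i)) = x + (\<Sum>i<2 * t + 1. x ^ (2 ^ Suc i))"
    by (subst sum.lessThan_Suc_shift) simp
  moreover have "(\<Sum>i<Suc (2 * t + 1). x ^ (2 ^ i)) = Tr x + x"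
    using assms by (simp add: Tr_def F_def d_def del: power_Suc)
  ultimately show ?thesis
    by (metis add.commute add_left_cancel)
qed

lemma Tr_square: "(Tr x)\<^sup>2 = Tr (x\<^sup>2)"
proof -
  have "(\<Sum>i<n. x ^ (2 ^ i))\<^sup>2 = (\<Sum>i<n. (x\<^sup>2) ^ (2 ^ i))" for n
    by (induction n) (simp_all add: square_add power_mult[symmetric] mult.commute)
  then show ?thesis
    by (simp only: Tr_def)
qed

lemma Tr_cases: "x \<in> F \<Longrightarrow> Tr x = 0 \<or> Tr x = 1"
  using Tr_square Tr_square_arg by (metis power2_eq_square mult_cancel_right1)

text \<open>An odd number of ones is summed in characteristic 2. Hence \<open>\<chi>\<close> is
  nontrivial.\<close>

lemma Tr_1: "Tr 1 = 1"
  by (simp add: Tr_def char2)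

definition \<chi> :: "'a \<Rightarrow> real" where
  "\<chi> x = (if Tr x = 0 then 1 else -1)"

lemma \<chi>_range: "\<chi> x \<in> {1, -1}"
  by (simp add: \<chi>_def)

lemma \<chi>_0 [simp]: "\<chi> 0 = 1"
  by (simp add: \<chi>_def Tr_def power_0_left)

lemma \<chi>_1 [simp]: "\<chi> 1 = -1"
  by (simp add: \<chi>_def Tr_1)

lemma \<chi>_add: "x \<in> F \<Longrightarrow> y \<in> F \<Longrightarrow> \<chi> (x + y) = \<chi> x * \<chi> y"
  using Tr_cases[of x] Tr_cases[of y] by (auto simp: \<chi>_def Tr_add)

lemma \<chi>_square: "x \<in> F \<Longrightarrow> \<chi> (x\<^sup>2) = \<chi> x"
  by (simp add: \<chi>_def Tr_square_arg)

lemma sum_translate: "c \<in> F \<Longrightarrow> (\<Sum>x\<in>F. f (x + c)) = (\<Sum>x\<in>F. f x)"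
  by (rule sum.reindex_bij_witness[of _ "\<lambda>x. x + c" "\<lambda>x. x + c"]) (auto simp: add.assoc)

text \<open>Orthogonality: for \<open>c \<noteq> 0\<close>, translating \<open>x\<close> by
  \<open>inverse c\<close> multiplies the sum by \<open>\<chi> 1 = -1\<close>, so it equals its own
  negative.\<close>

lemma sum_\<chi>_mult:
  assumes "c \<in> F"
  shows "(\<Sum>x\<in>F. \<chi> (c * x)) = (if c = 0 then real d else 0)"
proof (cases "c = 0")
  case False
  have "(\<Sum>x\<in>F. \<chi> (c * x)) = (\<Sum>x\<in>F. \<chi> (c * (x + inverse c)))"
    using assms sum_translate[of "inverse c" "\<lambda>x. \<chi> (c * x)"] by (simp add: inverse_closed)
  also have "\<dots> = (\<Sum>x\<in>F. \<chi> (c * x) * \<chi> 1)"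
    using assms False by (intro sum.cong) (auto simp: distrib_left mult_closed one_closed \<chi>_add)
  finally show ?thesis
    using False by (simp add: sum_negf)
qed (simp add: card_F)

text \<open>The Frobenius map is injective, hence permutes the finite set \<open>F\<close>.\<close>

lemma sum_square_arg: "(\<Sum>x\<in>F. f (x\<^sup>2)) = (\<Sum>x\<in>F. f x)"
proof -
  have "inj_on (\<lambda>x. x\<^sup>2) F"
    by (rule inj_onI) (metis add_eq_0_iff_eq square_add zero_eq_power2)
  moreover from this have "(\<lambda>x. x\<^sup>2) ` F = F"
    using finite_F by (intro endo_inj_surj) auto
  ultimately show ?thesis
    by (metis (no_types, lifting) sum.reindex_cong)
qed

section \<open>Inversion and cube roots\<close>

lemma power_d_minus_2:
  assumes "x \<in> F" "x \<noteq> 0"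
  shows "x ^ (d - 2) = inverse x"
proof -
  have "d \<ge> 2"
    by (simp add: d_def)
  then have "d = Suc (Suc (d - 2))"
    by simp
  then have "x ^ (d - 2) * x * x = x"
    using assms(1) by (metis (mono_tags) F_def mem_Collect_eq power_Suc2)
  then show ?thesis
    using assms(2) by (simp add: inverse_unique mult.commute)
qed

text \<open>Since \<open>3\<close> divides \<open>d - 2\<close>, inversion is a power of cubing on \<open>F\<close>.\<close>

lemma cube_root_in_F:
  assumes "u \<in> F" "u \<noteq> 0"
  obtains z where "z \<in> F" "z \<noteq> 0" "\<And>y. y \<in> F \<Longrightarrow> u * y ^ 3 = 1 \<longleftrightarrow> y = z"
proof -
  \<comment> \<open>The odd exponent of \<open>d\<close> enters here: \<open>2 ^ (2 * t)\<close> is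
    a power of 4, so 3 divides \<open>d - 2 = 2 * (2 ^ (2 * t) - 1)\<close>.\<close>
  have "(2 :: nat) ^ (2 * t) mod 3 = 1"
    using power_mod[of "4 :: nat" 3 t] by (simp add: power_mult)
  then obtain k where "(2 :: nat) ^ (2 * t) = 1 + 3 * k"
    by (metis add.commute mult_div_mod_eq)
  then have e: "d - 2 = 3 * (2 * k)"
    by (simp add: d_def)
  have root: "(x ^ 3) ^ (2 * k) = inverse x" if "x \<in> F" "x \<noteq> 0" for x
    using power_d_minus_2[OF that] by (simp add: e power_mult)
  show ?thesis
  proof (rule that[of "u ^ (2 * k)"])
    fix y assume y: "y \<in> F"
    show "u * y ^ 3 = 1 \<longleftrightarrow> y = u ^ (2 * k)"
    proof
      assume *: "u * y ^ 3 = 1"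
      then have "y \<noteq> 0"
        by auto
      from * have "u ^ (2 * k) * (y ^ 3) ^ (2 * k) = 1"
        by (metis power_mult_distrib power_one)
      then have "u ^ (2 * k) * inverse y = 1"
        by (simp only: root[OF y \<open>y \<noteq> 0\<close>])
      then show "y = u ^ (2 * k)"
        using \<open>y \<noteq> 0\<close> by (simp add: field_simps)
    next
      assume "y = u ^ (2 * k)"
      then have "y ^ 3 = (u ^ 3) ^ (2 * k)"
        by (simp add: mult.commute flip: power_mult)
      then show "u * y ^ 3 = 1"
        using root[OF assms] assms by simp
    qed
  qed (use assms in auto)
qed

section \<open>Walsh coefficients of cubics\<close>

definition walsh :: "'a \<Rightarrow> 'a \<Rightarrow> real" where
  "walsh u v = (\<Sum>x\<in>F. \<chi> (u * x ^ 3 + v * x))"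

text \<open>After cancellation the mixed terms are \<open>u * y * x\<^sup>2\<close> and
  \<open>u * x * y\<^sup>2\<close>. The second may be squared under \<open>\<chi>\<close>, so that
  \<open>x\<close> enters only through \<open>x\<^sup>2\<close>, and linearly in it.\<close>

lemma \<chi>_cubic_derivative:
  assumes "u \<in> F" "v \<in> F" "x \<in> F" "y \<in> F"
  shows "\<chi> (u * x ^ 3 + v * x) * \<chi> (u * (x + y) ^ 3 + v * (x + y)) =
    \<chi> (u * y ^ 3 + v * y) * \<chi> ((u * y + u\<^sup>2 * y ^ 4) * x\<^sup>2)"
proof -
  have cube: "(x + y) ^ 3 = x ^ 3 + x\<^sup>2 * y + x * y\<^sup>2 + y ^ 3"
  proof -
    have "(x + y) ^ 3 = (x + y) * (x + y)\<^sup>2"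
      by (simp add: power3_eq_cube power2_eq_square)
    then show ?thesis
      by (simp add: square_add) (simp add: algebra_simps power3_eq_cube power2_eq_square)
  qed
  have "\<chi> (u * x ^ 3 + v * x) * \<chi> (u * (x + y) ^ 3 + v * (x + y)) =
      \<chi> ((u * x ^ 3 + v * x) + (u * (x + y) ^ 3 + v * (x + y)))"
    using assms by (subst \<chi>_add) auto
  also have "(u * x ^ 3 + v * x) + (u * (x + y) ^ 3 + v * (x + y)) =
      (u * y ^ 3 + v * y) + (u * y * x\<^sup>2 + u * x * y\<^sup>2)"
    unfolding cube by (simp add: algebra_simps)
  also have "\<chi> \<dots> = \<chi> (u * y ^ 3 + v * y) * (\<chi> (u * y * x\<^sup>2) * \<chi> (u * x * y\<^sup>2))"
    using assms by (subst \<chi>_add; (subst \<chi>_add)?) auto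
  also have "\<chi> (u * x * y\<^sup>2) = \<chi> ((u * x * y\<^sup>2)\<^sup>2)"
    using assms by (subst \<chi>_square) auto
  also have "(u * x * y\<^sup>2)\<^sup>2 = u\<^sup>2 * y ^ 4 * x\<^sup>2"
    by (simp add: power_mult_distrib mult_ac flip: power_mult)
  also have "\<chi> (u * y * x\<^sup>2) * \<chi> (u\<^sup>2 * y ^ 4 * x\<^sup>2) = \<chi> ((u * y + u\<^sup>2 * y ^ 4) * x\<^sup>2)"
    using assms by (subst \<chi>_add[symmetric]) (auto simp: distrib_right)
  finally show ?thesis .
qed

text \<open>Expanding the square and writing the second variable as \<open>x + y\<close> leaves, for
  each \<open>y\<close>, a full character sum over \<open>x\<^sup>2\<close>; by orthogonality only
  \<open>y\<close> in the radical survive.\<close>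

lemma walsh_squared:
  assumes "u \<in> F" "v \<in> F"
  shows "(walsh u v)\<^sup>2 = real d * (\<Sum>y | y \<in> F \<and> u * y + u\<^sup>2 * y ^ 4 = 0. \<chi> (u * y ^ 3 + v * y))"
proof -
  let ?q = "\<lambda>x. u * x ^ 3 + v * x"
  have "(walsh u v)\<^sup>2 = (\<Sum>x\<in>F. \<Sum>z\<in>F. \<chi> (?q x) * \<chi> (?q z))"
    by (simp add: walsh_def power2_eq_square sum_product)
  also have "\<dots> = (\<Sum>x\<in>F. \<Sum>y\<in>F. \<chi> (?q x) * \<chi> (?q (x + y)))"
  proof (rule sum.cong[OF refl])
    fix x assume "x \<in> F"
    from sum_translate[OF this, of "\<lambda>z. \<chi> (?q x) * \<chi> (?q z)"]
    show "(\<Sum>z\<in>F. \<chi> (?q x) * \<chi> (?q z)) = (\<Sum>y\<in>F. \<chi> (?q x) * \<chi> (?q (x + y)))"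
      by (simp add: add.commute)
  qed
  also have "\<dots> = (\<Sum>y\<in>F. \<Sum>x\<in>F. \<chi> (?q y) * \<chi> ((u * y + u\<^sup>2 * y ^ 4) * x\<^sup>2))"
    using assms by (subst sum.swap) (intro sum.cong refl, rule \<chi>_cubic_derivative)
  also have "\<dots> = (\<Sum>y\<in>F. \<chi> (?q y) * (\<Sum>x\<in>F. \<chi> ((u * y + u\<^sup>2 * y ^ 4) * x)))"
    by (simp add: sum_square_arg[of "\<lambda>x. \<chi> (_ * x)"] flip: sum_distrib_left)
  also have "\<dots> = (\<Sum>y\<in>F. if u * y + u\<^sup>2 * y ^ 4 = 0 then real d * \<chi> (?q y) else 0)"
  proof (rule sum.cong[OF refl])
    fix y assume "y \<in> F"
    then have "u * y + u\<^sup>2 * y ^ 4 \<in> F"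
      using assms by auto
    then show "\<chi> (?q y) * (\<Sum>x\<in>F. \<chi> ((u * y + u\<^sup>2 * y ^ 4) * x)) =
        (if u * y + u\<^sup>2 * y ^ 4 = 0 then real d * \<chi> (?q y) else 0)"
      by (simp add: sum_\<chi>_mult)
  qed
  also have "\<dots> = (\<Sum>y | y \<in> F \<and> u * y + u\<^sup>2 * y ^ 4 = 0. real d * \<chi> (?q y))"
    using finite_F by (subst sum.inter_filter[symmetric]) auto
  finally show ?thesis
    by (simp add: sum_distrib_left)
qed

text \<open>The radical equation factors as \<open>u * y * (1 + u * y ^ 3) = 0\<close>, with
  solutions 0 and the unique cube root \<open>z\<close>. They contribute 1 and a sign.\<close>

lemma walsh_squared_cases:
  assumes "u \<in> F" "v \<in> F" "u \<noteq> 0"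
  shows "(walsh u v)\<^sup>2 = 0 \<or> (walsh u v)\<^sup>2 = 2 * real d"
proof -
  obtain z where z: "z \<in> F" "z \<noteq> 0" "\<And>y. y \<in> F \<Longrightarrow> u * y ^ 3 = 1 \<longleftrightarrow> y = z"
    using cube_root_in_F[OF assms(1,3)] by blast
  have "u * y + u\<^sup>2 * y ^ 4 = u * y * (1 + u * y ^ 3)" for y
    by (simp add: algebra_simps power2_eq_square power3_eq_cube power4_eq_xxxx)
  then have "{y. y \<in> F \<and> u * y + u\<^sup>2 * y ^ 4 = 0} = {0, z}"
    using assms(3) z by (auto simp: add_eq_0_iff_eq eq_commute[of 1])
  then have "(walsh u v)\<^sup>2 = real d * (1 + \<chi> (u * z ^ 3 + v * z))"
    using assms z(2) by (simp add: walsh_squared)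
  then show ?thesis
    using \<chi>_range[of "u * z ^ 3 + v * z"] by auto
qed

lemma walsh_0: "v \<in> F \<Longrightarrow> walsh 0 v = (if v = 0 then real d else 0)"
  by (simp add: walsh_def sum_\<chi>_mult)

section \<open>The family of weighing matrices\<close>

lemma exists_MQUWM:
  assumes "t > 0"
  shows "\<exists>S. finite S \<and> card S = d \<and> MQUWM d d (d div 2) (2 * d) S"
proof -
  obtain f where f: "bij_betw f {..<d} F"
    using ex_bij_betw_nat_finite[OF finite_F] card_F by (auto simp: atLeast0LessThan)
  have fF: "f i \<in> F" if "i < d" for i
    using f that by (auto simp: bij_betw_def)
  have f_eq: "f i = f j \<longleftrightarrow> i = j" if "i < d" "j < d" for i j
    using f that by (auto simp: bij_betw_def inj_on_def)
  define W where "W a = mat d d (\<lambda>(i, j). \<chi> (a * f j ^ 3 + f i * f j))" for a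
  have W_carrier [simp]: "W a \<in> carrier_mat d d" for a
    by (simp add: W_def)
  \<comment> \<open>The sums \<open>a + c\<close> and \<open>f i + f j\<close> are differences,
    since signs vanish in characteristic 2.\<close>
  have prod: "(W a * transpose_mat (W c)) $$ (i, j) = walsh (a + c) (f i + f j)"
    if "a \<in> F" "c \<in> F" "i < d" "j < d" for a c i j
  proof -
    have "(W a * transpose_mat (W c)) $$ (i, j) =
        (\<Sum>k<d. \<chi> (a * f k ^ 3 + f i * f k) * \<chi> (c * f k ^ 3 + f j * f k))"
      using that by (simp add: W_def scalar_prod_def atLeast0LessThan)
    also have "\<dots> = (\<Sum>k<d. \<chi> ((a + c) * f k ^ 3 + (f i + f j) * f k))"
    proof (rule sum.cong[OF refl])
      fix k assume "k \<in> {..<d}"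
      then show "\<chi> (a * f k ^ 3 + f i * f k) * \<chi> (c * f k ^ 3 + f j * f k) =
          \<chi> ((a + c) * f k ^ 3 + (f i + f j) * f k)"
        using that fF by (subst \<chi>_add[symmetric]) (auto simp: algebra_simps)
    qed
    also have "\<dots> = walsh (a + c) (f i + f j)"
      unfolding walsh_def by (rule sum.reindex_bij_betw[OF f])
    finally show ?thesis .
  qed
  have hadamard: "W a * transpose_mat (W a) = real d \<cdot>\<^sub>m 1\<^sub>m d" if "a \<in> F" for a
  proof (rule eq_matI)
    fix i j assume "i < dim_row (real d \<cdot>\<^sub>m 1\<^sub>m d)" "j < dim_col (real d \<cdot>\<^sub>m 1\<^sub>m d)"
    then have ij: "i < d" "j < d"
      by auto
    then show "(W a * transpose_mat (W a)) $$ (i, j) = (real d \<cdot>\<^sub>m 1\<^sub>m d) $$ (i, j)"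
      using prod[OF that that ij] fF by (simp add: walsh_0 add_closed add_eq_0_iff_eq f_eq)
  qed (simp_all add: W_def)
  have weighing: "weighing_matrix d d (W a)" if "a \<in> F" for a
    unfolding weighing_matrix_def
    using hadamard[OF that] \<chi>_range by (auto simp: W_def elements_mat_def)
  have unbiased: "quasi_unbiased d d (d div 2) (2 * d) (W a) (W c)"
    if "a \<in> F" "c \<in> F" "a \<noteq> c" for a c
  proof -
    define P where "P = W a * transpose_mat (W c)"
    define s where "s = 1 / sqrt (real (2 * d))"
    have s2: "s * s = 1 / (2 * real d)"
      by (simp add: s_def)
    have P_carrier [simp]: "P \<in> carrier_mat d d"
      unfolding P_def by (rule mult_carrier_mat[of _ _ d]) simp_all
    have "s * P $$ (i, j) \<in> {0, 1, -1}" if "i < d" "j < d" for i j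
    proof -
      have "a + c \<noteq> 0"
        using \<open>a \<noteq> c\<close> by (simp add: add_eq_0_iff_eq)
      then have "(P $$ (i, j))\<^sup>2 = 0 \<or> (P $$ (i, j))\<^sup>2 = 2 * real d"
        unfolding P_def prod[OF \<open>a \<in> F\<close> \<open>c \<in> F\<close> that]
        using \<open>a \<in> F\<close> \<open>c \<in> F\<close> that fF by (intro walsh_squared_cases) auto
      then have "(s * P $$ (i, j))\<^sup>2 = 0 \<or> (s * P $$ (i, j))\<^sup>2 = 1"
        using s2 d_pos by (auto simp: power_mult_distrib power2_eq_square[of s])
      then show ?thesis
        by (auto simp: power2_eq_1_iff)
    qed
    then have entries: "elements_mat (s \<cdot>\<^sub>m P) \<subseteq> {0, 1, -1}"
      using carrier_matD[OF P_carrier] by (fastforce simp: elements_mat_def)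
    \<comment> \<open>This product sits in the middle of \<open>P * transpose_mat P\<close>. It is
      obtained from \<open>hadamard\<close> because a right inverse of a square matrix is also a
      left inverse.\<close>
    have WcWc: "transpose_mat (W c) * W c = real d \<cdot>\<^sub>m 1\<^sub>m d"
    proof -
      have "((1 / real d) \<cdot>\<^sub>m transpose_mat (W c)) * W c = 1\<^sub>m d"
      proof (rule mat_mult_left_right_inverse)
        have "W c * ((1 / real d) \<cdot>\<^sub>m transpose_mat (W c)) =
            (1 / real d) \<cdot>\<^sub>m (W c * transpose_mat (W c))"
          by (rule mult_smult_distrib[of _ d d _ d]) simp_all
        also have "\<dots> = 1\<^sub>m d"
          using d_pos by (auto simp: hadamard[OF that(2)])
        finally show "W c * ((1 / real d) \<cdot>\<^sub>m transpose_mat (W c)) = 1\<^sub>m d" .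
      qed simp_all
      then have "(1 / real d) \<cdot>\<^sub>m (transpose_mat (W c) * W c) = 1\<^sub>m d"
        by (subst (asm) mult_smult_assoc_mat[of _ d d _ d]) simp_all
      then have "real d \<cdot>\<^sub>m ((1 / real d) \<cdot>\<^sub>m (transpose_mat (W c) * W c)) = real d \<cdot>\<^sub>m 1\<^sub>m d"
        by simp
      then show ?thesis
        using d_pos by (simp add: smult_smult_mat one_smult_mat)
    qed
    have PP: "P * transpose_mat P = (real d * real d) \<cdot>\<^sub>m 1\<^sub>m d"
    proof -
      have "transpose_mat P = W c * transpose_mat (W a)"
        unfolding P_def by (subst transpose_mult[of _ d d _ d]) simp_all
      then have "P * transpose_mat P = W a * (transpose_mat (W c) * W c) * transpose_mat (W a)"
        unfolding P_def
        by (simp add: assoc_mult_mat[of _ d d _ d _ d] mult_carrier_mat[of _ d d _ d])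
      also have "\<dots> = real d \<cdot>\<^sub>m (W a * transpose_mat (W a))"
        unfolding WcWc
        by (simp add: mult_smult_distrib[of _ d d _ d] mult_smult_assoc_mat[of _ d d _ d]
            right_mult_one_mat[of _ d d])
      finally show ?thesis
        by (simp add: hadamard[OF that(1)] smult_smult_mat)
    qed
    have "(s \<cdot>\<^sub>m P) * transpose_mat (s \<cdot>\<^sub>m P) = (s * s) \<cdot>\<^sub>m (P * transpose_mat P)"
      using P_carrier
      by (simp add: transpose_smult_mat mult_smult_distrib[of _ d d _ d]
          mult_smult_assoc_mat[of _ d d _ d] smult_smult_mat)
    \<comment> \<open>The new weight is \<open>d * d / (2 * d)\<close>; halving is exact because
      \<open>d\<close> is even.\<close>
    also have "\<dots> = real (d div 2) \<cdot>\<^sub>m 1\<^sub>m d"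
    proof -
      have half: "real (d div 2) = real d / 2"
        by (simp add: d_def)
      show ?thesis
        unfolding PP s2 half using d_pos by (simp add: smult_smult_mat)
    qed
    finally have "weighing_matrix d (d div 2) (s \<cdot>\<^sub>m P)"
      unfolding weighing_matrix_def using entries by simp
    moreover have "d div 2 > 0"
      by (simp add: d_def)
    ultimately show ?thesis
      unfolding quasi_unbiased_def using weighing that d_pos by (simp add: P_def s_def)
  qed
  \<comment> \<open>Needed for \<open>d\<close> distinct matrices. Equal matrices with
    \<open>a \<noteq> c\<close> would give a Walsh coefficient \<open>d\<close> whose square is 0 or
    \<open>2 * d\<close>, so \<open>d = 2\<close>, against \<open>t > 0\<close>.\<close>
  have "inj_on W F"
  proof (rule inj_onI, rule ccontr)
    fix a c assume ac: "a \<in> F" "c \<in> F" "W a = W c" "a \<noteq> c"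
    then have "walsh (a + c) (f 0 + f 0) = walsh (a + a) (f 0 + f 0)"
      using prod[of a c 0 0] prod[of a a 0 0] d_pos by simp
    then have "walsh (a + c) 0 = real d"
      by (simp add: walsh_0 zero_closed)
    moreover have "(walsh (a + c) 0)\<^sup>2 = 0 \<or> (walsh (a + c) 0)\<^sup>2 = 2 * real d"
      using ac by (intro walsh_squared_cases) (auto simp: add_eq_0_iff_eq)
    ultimately have "d = 2"
      using d_pos by (auto simp: power2_eq_square)
    then show False
      using assms by (simp add: d_def)
  qed
  then have "card (W ` F) = d"
    by (simp add: card_image card_F)
  moreover have "MQUWM d d (d div 2) (2 * d) (W ` F)"
    unfolding MQUWM_def using weighing unbiased by blast
  ultimately show ?thesis
    using finite_F by blast
qed

end

theorem theorem4p4: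
  fixes t d :: nat
  assumes "t > 0" and "d = 2 ^ (2 * t + 1)"
  shows "\<exists>S. finite S \<and> card S = d \<and> MQUWM d d (d div 2) (2 * d) S"
proof -
  \<comment> \<open>The fixed points of \<open>x ^ d\<close> in the algebraic closure of the
    two-element field number exactly \<open>d\<close>, as the exponent \<open>2 * t + 1\<close> is
    positive.\<close>
  interpret odd_binary_field "{x :: bit alg_closure. x ^ d = x}" t d
    using card_power_fixpoints_char_2[OF two_eq_0_bit_alg_closure, of "2 * t + 1"]
    by unfold_locales (simp_all add: assms(2) two_eq_0_bit_alg_closure)
  show ?thesis
    by (rule exists_MQUWM[OF assms(1)])
qed

end
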